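(* Let $Q=(q_{ij})_{1\le i,j\le N}$ be an irreducible transition rate matrix with steady-state distribution $\mu=(\mu_1,\dots,\mu_N)$. There exists a constant $c_1>0$, depending only on $Q$, such that for every solution $p(t)=(p_1(t),\dots,p_N(t))$ of the master equation $\frac{dp}{dt}=pQ$ starting from a probability distribution $p(0)$, and every $t\ge0$ at which all components of $p(t)$ are positive (in particular every $t>0$), writing $p_i=p_i(t)$, $$e_p^{(na)} = -\frac{dF}{dt} \;\ge\; c_1\sum_i\Big[\sum_{j\neq i}(p_jq_{ji}-p_iq_{ij})\Big]^2 ,$$ where $$e_p^{(na)}=\frac12\sum_{i,j}(p_iq_{ij}-p_jq_{ji})\log\frac{p_i\mu_j}{p_j\mu_i},\qquad F=\sum_i p_i\log\frac{p_i}{\mu_i}.$$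
   Context: Transition rate matrix on the finite state space $\{1,\dots,N\}$: a real matrix $Q=(q_{ij})$ with $q_{ij}\ge 0$ for $i\ne j$ and $q_{ii}=-\sum_{j\ne i}q_{ij}$. Irreducible: for each pair of states $i\neq j$ there is a sequence of states $i_1=i,i_2,\dots,i_m=j$ with $q_{i_1i_2}q_{i_2i_3}\cdots q_{i_{m-1}i_m}>0$. Under irreducibility there is a unique probability distribution $\mu$ with $\mu Q=0$ (the steady-state distribution), and all its components are positive. For any initial probability distribution $p(0)$, the solution $p(t)$ (a row vector) of $dp/dt=pQ$ is a probability distribution for all $t\ge 0$, and all its components are positive for $t>0$. The quantity $e_p^{(na)}$ is called the non-adiabatic entropy production rate, $F$ the free energy, and $f_d=-dF/dt$ the free energy dissipation rate; the derivative is along the solution $p(t)$ (one-sided at $t=0$). No detailed balance is assumed. *)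

theory Defs
  imports "HOL-Analysis.Analysis"
begin

text \<open>
  States form a finite type; \<open>Q $ i $ j\<close> is the rate from \<open>i\<close> to \<open>j\<close>. Distributions are row
  vectors, so that they multiply rate matrices from the left (\<open>v*\<close>).
\<close>

definition transition_rate_matrix :: "real^'n^'n \<Rightarrow> bool" where
  "transition_rate_matrix Q \<longleftrightarrow>
     (\<forall>i j. i \<noteq> j \<longrightarrow> 0 \<le> Q $ i $ j) \<and>
     (\<forall>i. Q $ i $ i = - (\<Sum>j\<in>UNIV - {i}. Q $ i $ j))"

text \<open>
  The path is indexed from \<open>0\<close>. The empty product (\<open>m = 0\<close>) cannot be used, since \<open>i \<noteq> j\<close>.
\<close>

definition irreducible_rates :: "real^'n^'n \<Rightarrow> bool" where
  "irreducible_rates Q \<longleftrightarrow>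
     (\<forall>i j. i \<noteq> j \<longrightarrow>
       (\<exists>(m::nat) s. s 0 = i \<and> s m = j \<and> 0 < (\<Prod>k<m. Q $ s k $ s (Suc k))))"

definition prob_vector :: "real^'n \<Rightarrow> bool" where
  "prob_vector p \<longleftrightarrow> (\<forall>i. 0 \<le> p $ i) \<and> (\<Sum>i\<in>UNIV. p $ i) = 1"

definition steady_state :: "real^'n^'n \<Rightarrow> real^'n \<Rightarrow> bool" where
  "steady_state Q \<mu> \<longleftrightarrow> prob_vector \<mu> \<and> \<mu> v* Q = 0"

text \<open>
  Solutions live on \<open>{0..}\<close>; the derivative is one-sided at \<open>0\<close>, and values at negative times are
  irrelevant.
\<close>

definition master_solution :: "real^'n^'n \<Rightarrow> (real \<Rightarrow> real^'n) \<Rightarrow> bool" where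
  "master_solution Q p \<longleftrightarrow>
     (\<forall>t\<ge>0. (p has_vector_derivative (p t v* Q)) (at t within {0..}))"

definition free_energy :: "real^'n \<Rightarrow> real^'n \<Rightarrow> real" where
  "free_energy \<mu> p = (\<Sum>i\<in>UNIV. p $ i * ln (p $ i / \<mu> $ i))"

definition nonadiabatic_epr :: "real^'n^'n \<Rightarrow> real^'n \<Rightarrow> real^'n \<Rightarrow> real" where
  "nonadiabatic_epr Q \<mu> p =
     1 / 2 * (\<Sum>i\<in>UNIV. \<Sum>j\<in>UNIV. (p $ i * Q $ i $ j - p $ j * Q $ j $ i) *
       ln ((p $ i * \<mu> $ j) / (p $ j * \<mu> $ i)))"

end

theory Submission
  imports Defs
begin

text \<open>
  With \<open>x\<^sub>i = p\<^sub>i / \<mu>\<^sub>i\<close>, stationarity of \<open>\<mu>\<close> and vanishing row sums of \<open>Q\<close> turn the entropy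
  production into \<open>\<Sum> \<mu>\<^sub>j q\<^sub>j\<^sub>i (x\<^sub>j ln (x\<^sub>j / x\<^sub>i) - x\<^sub>j + x\<^sub>i)\<close>, each term of which is at least
  \<open>\<mu>\<^sub>j q\<^sub>j\<^sub>i (sqrt x\<^sub>j - sqrt x\<^sub>i)\<^sup>2\<close>. The net inflow into \<open>i\<close> is \<open>\<Sum>\<^sub>j \<mu>\<^sub>j q\<^sub>j\<^sub>i (x\<^sub>j - x\<^sub>i)\<close>, and
  Cauchy-Schwarz compares the two. A solution stays nonnegative because the squared norm of its
  negative part satisfies a Gronwall inequality; it becomes positive because a zero at \<open>t > 0\<close> is a
  minimum, where the derivative, i.e. the inflow, vanishes.
\<close>

section \<open>Rate matrices and positivity of the steady state\<close>

lemma vector_matrix_mult_nth: "(v v* Q) $ j = (\<Sum>i\<in>UNIV. v $ i * Q $ i $ j)"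
  for Q :: "real^'n^'n"
  by (simp add: vector_matrix_mult_def)

lemma transition_rate_matrix_nonneg:
  "transition_rate_matrix Q \<Longrightarrow> i \<noteq> j \<Longrightarrow> 0 \<le> Q $ i $ j"
  by (simp add: transition_rate_matrix_def)

lemma transition_rate_matrix_row_sum:
  assumes "transition_rate_matrix Q"
  shows "(\<Sum>j\<in>UNIV. Q $ i $ j) = 0"
proof -
  have "(\<Sum>j\<in>UNIV. Q $ i $ j) = Q $ i $ i + (\<Sum>j\<in>UNIV - {i}. Q $ i $ j)"
    by (rule sum.remove) auto
  then show ?thesis
    using assms by (simp add: transition_rate_matrix_def)
qed

lemma transition_rate_matrix_diag_nonpos:
  assumes "transition_rate_matrix Q"
  shows "Q $ i $ i \<le> 0"
proof -
  have "0 \<le> (\<Sum>j\<in>UNIV - {i}. Q $ i $ j)"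
    using assms by (intro sum_nonneg transition_rate_matrix_nonneg) auto
  then show ?thesis
    using assms by (simp add: transition_rate_matrix_def)
qed

text \<open>Infinitesimal conservation of total mass: after exchanging the sums, every row sum of
  \<open>Q\<close> vanishes.\<close>

lemma sum_vector_matrix_mult_rate:
  assumes "transition_rate_matrix Q"
  shows "(\<Sum>j\<in>UNIV. (v v* Q) $ j) = 0"
proof -
  have "(\<Sum>j\<in>UNIV. (v v* Q) $ j) = (\<Sum>j\<in>UNIV. \<Sum>i\<in>UNIV. v $ i * Q $ i $ j)"
    by (simp only: vector_matrix_mult_nth)
  also have "\<dots> = (\<Sum>i\<in>UNIV. \<Sum>j\<in>UNIV. v $ i * Q $ i $ j)"
    by (rule sum.swap)
  also have "\<dots> = (\<Sum>i\<in>UNIV. v $ i * (\<Sum>j\<in>UNIV. Q $ i $ j))"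
    by (simp add: sum_distrib_left)
  also have "\<dots> = 0"
    by (simp add: transition_rate_matrix_row_sum[OF assms])
  finally show ?thesis .
qed

text \<open>
  If a component vanishes together with its net inflow, then so do all components it receives
  from; irreducibility spreads this to every state.
\<close>

lemma prob_vector_pos_if_no_inflow_at_zeros:
  fixes Q :: "real^'n^'n"
  assumes Q: "transition_rate_matrix Q" "irreducible_rates Q"
    and v: "prob_vector v"
    and zero: "\<And>j. v $ j = 0 \<Longrightarrow> (v v* Q) $ j = 0"
  shows "0 < v $ j"
proof (rule ccontr)
  assume "\<not> 0 < v $ j"
  moreover have nn: "0 \<le> v $ i" for i
    using v by (simp add: prob_vector_def)
  ultimately have j: "v $ j = 0"
    by (simp add: order_less_le)
  have predecessor: "v $ a = 0" if "v $ b = 0" "Q $ a $ b \<noteq> 0" for a b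
  proof (cases "a = b")
    case False
    \<comment> \<open>The one possibly negative rate, \<open>Q $ b $ b\<close>, is multiplied by
      \<open>v $ b = 0\<close>, so the vanishing inflow is a sum of nonnegative terms.\<close>
    have "v $ i * Q $ i $ b \<ge> 0" for i
      using nn transition_rate_matrix_nonneg[OF Q(1)] that(1)
      by (cases "i = b") auto
    moreover have "(\<Sum>i\<in>UNIV. v $ i * Q $ i $ b) = 0"
      using zero[OF that(1)] by (simp add: vector_matrix_mult_nth)
    ultimately have "v $ a * Q $ a $ b = 0"
      by (simp add: sum_nonneg_eq_0_iff)
    then show ?thesis
      using that(2) by simp
  qed (use that in simp)
  have "v $ i = 0" for i
  proof (cases "i = j")
    case False
    then obtain m :: nat and s where s: "s 0 = i" "s m = j"
      and prod: "0 < (\<Prod>k<m. Q $ s k $ s (Suc k))"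
      using Q(2) unfolding irreducible_rates_def by blast
    \<comment> \<open>A path may repeat a state in consecutive positions, and diagonal rates can be
      negative; hence factors are shown to be nonzero rather than positive.\<close>
    have ne: "Q $ s k $ s (Suc k) \<noteq> 0" if "k < m" for k
    proof
      assume "Q $ s k $ s (Suc k) = 0"
      then have "(\<Prod>k<m. Q $ s k $ s (Suc k)) = 0"
        using that by (intro prod_zero) auto
      then show False
        using prod by linarith
    qed
    \<comment> \<open>Zeros travel against the direction of the jumps, so the induction descends
      from \<open>s m = j\<close> to \<open>s 0 = i\<close>.\<close>
    have "v $ s k = 0" if "k \<le> m" for k
      using that
    proof (induction rule: inc_induct)
      case base
      then show ?case using j s by simp
    next
      case (step k)
      then show ?case using predecessor ne by blast
    qed
    then show ?thesis
      using s(1) by blast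
  qed (use j in simp)
  then have "(\<Sum>i\<in>UNIV. v $ i) = 0"
    by simp
  then show False
    using v by (simp add: prob_vector_def)
qed

lemma steady_state_pos:
  assumes "transition_rate_matrix Q" "irreducible_rates Q" "steady_state Q \<mu>"
  shows "0 < \<mu> $ i"
  using assms
  by (intro prob_vector_pos_if_no_inflow_at_zeros[of Q]) (auto simp: steady_state_def)

section \<open>Solutions of the master equation: nonnegativity, total mass, positivity\<close>

lemma master_solution_component_deriv:
  assumes "master_solution Q p" "0 \<le> t"
  shows "((\<lambda>s. p s $ i) has_real_derivative (p t v* Q) $ i) (at t within {0..})"
proof -
  have "(p has_vector_derivative (p t v* Q)) (at t within {0..})"
    using assms by (simp add: master_solution_def)
  from bounded_linear.has_vector_derivative[OF bounded_linear_vec_nth[of i] this]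
  show ?thesis
    by (simp add: has_real_derivative_iff_has_vector_derivative)
qed

lemma at_within_atLeast_interior: "(t::real) > 0 \<Longrightarrow> at t within {0..} = at t"
  by (rule at_within_interior) simp

text \<open>Squaring removes the kink of the negative part at 0, so the chain rule applies to it
  along a solution. At 0 the difference quotient is bounded by \<open>\<bar>h\<bar>\<close>.\<close>

lemma has_real_derivative_min_0_sq:
  "((\<lambda>x::real. (min x 0)\<^sup>2) has_real_derivative 2 * min x 0) (at x)"
proof (cases x "0::real" rule: linorder_cases)
  case less
  have "((\<lambda>x::real. x\<^sup>2) has_real_derivative 2 * min x 0) (at x)"
    using less by (auto intro!: derivative_eq_intros)
  then show ?thesis
    by (rule has_field_derivative_transform_within_open[where S = "{..<0}"]) (use less in auto)
next
  case equal
  have "((\<lambda>h::real. (min h 0)\<^sup>2 / h) \<longlongrightarrow> 0) (at 0)"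
  proof (rule Lim_null_comparison)
    show "\<forall>\<^sub>F h in at 0. norm ((min h 0)\<^sup>2 / h :: real) \<le> \<bar>h\<bar>"
      by (rule always_eventually) (auto simp: min_def power2_eq_square)
  qed (auto intro: tendsto_rabs_zero)
  then show ?thesis
    using equal by (simp add: DERIV_def)
next
  case greater
  have "((\<lambda>x::real. 0) has_real_derivative 2 * min x 0) (at x)"
    using greater by (auto intro!: derivative_eq_intros)
  then show ?thesis
    by (rule has_field_derivative_transform_within_open[where S = "{0<..}"]) (use greater in auto)
qed

text \<open>The integrating factor \<open>exp (- C * s)\<close> makes \<open>W\<close>
  nonincreasing. Two-sided derivatives exist only at positive times, so monotonicity comes from the
  open interval together with continuity at its endpoints.\<close>

lemma gronwall_zero:
  fixes V V' :: "real \<Rightarrow> real"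
  assumes deriv: "\<And>t. 0 \<le> t \<Longrightarrow> (V has_real_derivative V' t) (at t within {0..})"
    and le: "\<And>t. 0 \<le> t \<Longrightarrow> V' t \<le> C * V t"
    and "V 0 \<le> 0" "0 \<le> t"
  shows "V t \<le> 0"
proof -
  define W where "W s = exp (- C * s) * V s" for s
  have W: "(W has_real_derivative exp (- C * s) * (V' s - C * V s)) (at s within {0..})"
    if "0 \<le> s" for s
    unfolding W_def
    by (rule derivative_eq_intros deriv that refl | simp add: algebra_simps)+
  have "W t \<le> W 0"
  proof (rule DERIV_nonpos_imp_decreasing_open[where f = W and a = 0 and b = t])
    have "continuous_on {0..} W"
      using W by (intro DERIV_continuous_on) auto
    then show "continuous_on {0..t} W"
      by (rule continuous_on_subset) auto
    show "\<exists>y. (W has_real_derivative y) (at s) \<and> y \<le> 0" if "0 < s" "s < t" for s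
      using W[of s] le[of s] that
      by (intro exI[of _ "exp (- C * s) * (V' s - C * V s)"])
         (auto simp: at_within_atLeast_interior mult_nonneg_nonpos)
  qed (use assms in simp)
  also have "W 0 \<le> 0"
    using assms by (simp add: W_def)
  finally show ?thesis
    by (simp add: W_def mult_le_0_iff)
qed

text \<open>As \<open>min b 0\<close> is nonpositive, replacing \<open>a\<close> by the smaller
  \<open>min a 0\<close> can only increase the product; then 2xy \<le> x^2 + y^2 applies.\<close>

lemma min_0_flux_le:
  fixes a b q :: real
  assumes "0 \<le> q"
  shows "2 * min b 0 * (a * q) \<le> q * ((min a 0)\<^sup>2 + (min b 0)\<^sup>2)"
proof -
  have "2 * min b 0 * a \<le> 2 * min b 0 * min a 0"
    by (intro mult_left_mono_neg) auto
  also have "\<dots> \<le> (min a 0)\<^sup>2 + (min b 0)\<^sup>2"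
    using sum_squares_bound[of "min b 0" "min a 0"] by simp
  finally have "2 * min b 0 * a * q \<le> ((min a 0)\<^sup>2 + (min b 0)\<^sup>2) * q"
    using assms by (rule mult_right_mono)
  then show ?thesis
    by (simp add: algebra_simps)
qed

text \<open>Because off-diagonal rates are nonnegative, a negative component is pushed further down
  only by other negative components. Hence \<open>V' \<le> 2 * K * V\<close>, while \<open>V\<close>
  starts at 0.\<close>

lemma master_solution_nonneg:
  fixes Q :: "real^'n^'n"
  assumes Q: "transition_rate_matrix Q" and p: "master_solution Q p"
    and p0: "\<And>i. 0 \<le> p 0 $ i" and t: "0 \<le> t"
  shows "0 \<le> p t $ i"
proof -
  define V where "V s = (\<Sum>j\<in>UNIV. (min (p s $ j) 0)\<^sup>2)" for s
  define V' where "V' s = (\<Sum>j\<in>UNIV. 2 * min (p s $ j) 0 * (p s v* Q) $ j)" for s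
  define K where "K = (\<Sum>j\<in>UNIV. \<Sum>i\<in>UNIV. \<bar>Q $ i $ j\<bar>)"
  have V_ge: "(min (p s $ j) 0)\<^sup>2 \<le> V s" for s j
    unfolding V_def by (rule member_le_sum) auto
  have "V t \<le> 0"
  proof (rule gronwall_zero[where V = V and V' = V' and C = "2 * K"])
    show "V 0 \<le> 0"
      using p0 by (simp add: V_def min_absorb2)
    show "(V has_real_derivative V' s) (at s within {0..})" if "0 \<le> s" for s
      unfolding V_def V'_def
      by (intro DERIV_sum DERIV_chain2[OF has_real_derivative_min_0_sq]
          master_solution_component_deriv[OF p that])
    show "V' s \<le> (2 * K) * V s" if "0 \<le> s" for s
    proof -
      have flux_le: "2 * min (p s $ j) 0 * (p s $ i * Q $ i $ j) \<le> \<bar>Q $ i $ j\<bar> * (2 * V s)" for i j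
      proof (cases "i = j")
        case True
        \<comment> \<open>\<open>min b 0 * b\<close> is nonnegative and the diagonal rate
          nonpositive: the own outflow of a component damps its negative part.\<close>
        have "2 * min (p s $ j) 0 * (p s $ j * Q $ j $ j) \<le> 0"
          using transition_rate_matrix_diag_nonpos[OF Q, of j]
          by (auto simp: min_def mult_nonneg_nonpos mult_nonpos_nonpos mult_nonpos_nonneg)
        also have "0 \<le> \<bar>Q $ i $ j\<bar> * (2 * V s)"
          by (simp add: V_def sum_nonneg)
        finally show ?thesis
          using True by simp
      next
        case False
        then have nn: "0 \<le> Q $ i $ j"
          by (rule transition_rate_matrix_nonneg[OF Q])
        have "2 * min (p s $ j) 0 * (p s $ i * Q $ i $ j)
            \<le> Q $ i $ j * ((min (p s $ i) 0)\<^sup>2 + (min (p s $ j) 0)\<^sup>2)"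
          by (rule min_0_flux_le[OF nn])
        also have "\<dots> \<le> Q $ i $ j * (2 * V s)"
          using V_ge[of s i] V_ge[of s j] nn by (intro mult_left_mono) auto
        finally show ?thesis
          using nn by simp
      qed
      have "V' s = (\<Sum>j\<in>UNIV. \<Sum>i\<in>UNIV. 2 * min (p s $ j) 0 * (p s $ i * Q $ i $ j))"
        by (simp add: V'_def vector_matrix_mult_nth sum_distrib_left)
      also have "\<dots> \<le> (\<Sum>j\<in>UNIV. \<Sum>i\<in>UNIV. \<bar>Q $ i $ j\<bar> * (2 * V s))"
        by (intro sum_mono flux_le)
      also have "\<dots> = (2 * K) * V s"
        by (simp add: K_def sum_distrib_right sum_distrib_left algebra_simps)
      finally show ?thesis .
    qed
  qed (fact t)
  then have "(min (p t $ i) 0)\<^sup>2 \<le> 0"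
    using V_ge[of t i] by linarith
  then show ?thesis
    by (simp add: min_def split: if_splits)
qed

lemma master_solution_prob_vector:
  fixes Q :: "real^'n^'n"
  assumes Q: "transition_rate_matrix Q" and p: "master_solution Q p"
    and p0: "prob_vector (p 0)" and t: "0 \<le> t"
  shows "prob_vector (p t)"
proof -
  have "((\<lambda>s. \<Sum>i\<in>UNIV. p s $ i) has_real_derivative 0) (at s within {0..})" if "0 \<le> s" for s
  proof -
    have "((\<lambda>s. \<Sum>i\<in>UNIV. p s $ i) has_real_derivative (\<Sum>i\<in>UNIV. (p s v* Q) $ i))
        (at s within {0..})"
      by (intro DERIV_sum master_solution_component_deriv[OF p that])
    then show ?thesis
      by (simp add: sum_vector_matrix_mult_rate[OF Q])
  qed
  then obtain c where "\<And>s. 0 \<le> s \<Longrightarrow> (\<Sum>i\<in>UNIV. p s $ i) = c"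
    using has_field_derivative_zero_constant[of "{0..}" "\<lambda>s. \<Sum>i\<in>UNIV. p s $ i"]
    by auto
  then have "(\<Sum>i\<in>UNIV. p t $ i) = (\<Sum>i\<in>UNIV. p 0 $ i)"
    using t by simp
  then show ?thesis
    using p0 master_solution_nonneg[OF Q p _ t] by (simp add: prob_vector_def)
qed

lemma master_solution_pos:
  fixes Q :: "real^'n^'n"
  assumes Q: "transition_rate_matrix Q" "irreducible_rates Q" and p: "master_solution Q p"
    and p0: "prob_vector (p 0)" and t: "0 < t"
  shows "0 < p t $ i"
proof (rule prob_vector_pos_if_no_inflow_at_zeros[OF Q])
  have pv: "prob_vector (p s)" if "0 \<le> s" for s
    using master_solution_prob_vector[OF Q(1) p p0 that] .
  then show "prob_vector (p t)"
    using t by simp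
  show "(p t v* Q) $ j = 0" if "p t $ j = 0" for j
  \<comment> \<open>Radius \<open>t\<close> keeps the neighbourhood inside positive times, where all
    components are already known to be nonnegative; so the zero at \<open>t\<close> is a local
    minimum.\<close>
  proof (rule DERIV_local_min)
    show "((\<lambda>s. p s $ j) has_real_derivative (p t v* Q) $ j) (at t)"
      using master_solution_component_deriv[OF p, of t j] t
      by (simp add: at_within_atLeast_interior)
    show "\<forall>y. \<bar>t - y\<bar> < t \<longrightarrow> p t $ j \<le> p y $ j"
      using pv that by (auto simp: prob_vector_def)
  qed (fact t)
qed

section \<open>Entropy production as free energy dissipation\<close>

text \<open>The logarithm is antisymmetric in \<open>i\<close> and \<open>j\<close>, so the two
  halves of the flux difference contribute equally and absorb the factor 1/2.\<close>

lemma nonadiabatic_epr_eq: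
  fixes Q :: "real^'n^'n"
  assumes pos: "\<And>i. 0 < \<mu> $ i" "\<And>i. 0 < p $ i"
  shows "nonadiabatic_epr Q \<mu> p =
    (\<Sum>i\<in>UNIV. \<Sum>j\<in>UNIV. p $ j * Q $ j $ i * (ln (p $ j / \<mu> $ j) - ln (p $ i / \<mu> $ i)))"
    (is "_ = ?R")
proof -
  define L where "L i = ln (p $ i / \<mu> $ i)" for i
  have ln: "ln ((p $ i * \<mu> $ j) / (p $ j * \<mu> $ i)) = L i - L j" for i j
    using pos[of i] pos[of j] by (simp add: L_def ln_div ln_mult)
  let ?S = "\<Sum>i\<in>UNIV. \<Sum>j\<in>UNIV. p $ i * Q $ i $ j * (L i - L j)"
  have "2 * nonadiabatic_epr Q \<mu> p =
      (\<Sum>i\<in>UNIV. \<Sum>j\<in>UNIV. (p $ i * Q $ i $ j * (L i - L j) + p $ j * Q $ j $ i * (L j - L i)))"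
    unfolding nonadiabatic_epr_def ln by (simp add: algebra_simps)
  also have "\<dots> = ?S + (\<Sum>i\<in>UNIV. \<Sum>j\<in>UNIV. p $ j * Q $ j $ i * (L j - L i))"
    by (simp only: sum.distrib)
  also have "?S = (\<Sum>i\<in>UNIV. \<Sum>j\<in>UNIV. p $ j * Q $ j $ i * (L j - L i))"
    by (rule sum.swap)
  finally show ?thesis
    by (simp add: L_def)
qed

lemma nonadiabatic_epr_eq_flux:
  fixes Q :: "real^'n^'n"
  assumes Q: "transition_rate_matrix Q" and pos: "\<And>i. 0 < \<mu> $ i" "\<And>i. 0 < p $ i"
  shows "nonadiabatic_epr Q \<mu> p = - (\<Sum>i\<in>UNIV. (p v* Q) $ i * ln (p $ i / \<mu> $ i))"
proof -
  define L where "L i = ln (p $ i / \<mu> $ i)" for i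
  have "(\<Sum>i\<in>UNIV. \<Sum>j\<in>UNIV. p $ j * Q $ j $ i * L j) = (\<Sum>j\<in>UNIV. \<Sum>i\<in>UNIV. p $ j * Q $ j $ i * L j)"
    by (rule sum.swap)
  also have "\<dots> = (\<Sum>j\<in>UNIV. p $ j * L j * (\<Sum>i\<in>UNIV. Q $ j $ i))"
    by (simp add: sum_distrib_left algebra_simps)
  also have "\<dots> = 0"
    by (simp add: transition_rate_matrix_row_sum[OF Q])
  finally show ?thesis
    unfolding nonadiabatic_epr_eq[OF pos] vector_matrix_mult_nth L_def[symmetric]
    by (simp add: right_diff_distrib sum_subtractf sum_distrib_right)
qed

text \<open>The product rule leaves, besides the flux form of the entropy production, the sum of the
  components' derivatives, which vanishes by mass conservation.\<close>

lemma free_energy_deriv: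
  fixes Q :: "real^'n^'n"
  assumes Q: "transition_rate_matrix Q" and p: "master_solution Q p" and t: "0 \<le> t"
    and pos: "\<And>i. 0 < \<mu> $ i" "\<And>i. 0 < p t $ i"
  shows "((\<lambda>s. free_energy \<mu> (p s)) has_real_derivative - nonadiabatic_epr Q \<mu> (p t))
    (at t within {0..})"
proof -
  have "((\<lambda>s. p s $ i * ln (p s $ i / \<mu> $ i)) has_real_derivative
      (p t v* Q) $ i * ln (p t $ i / \<mu> $ i) + (p t v* Q) $ i) (at t within {0..})" for i
    using pos(1)[of i] pos(2)[of i]
    by (auto intro!: derivative_eq_intros master_solution_component_deriv[OF p t]
        simp: field_simps)
  then have "((\<lambda>s. free_energy \<mu> (p s)) has_real_derivative
      (\<Sum>i\<in>UNIV. (p t v* Q) $ i * ln (p t $ i / \<mu> $ i) + (p t v* Q) $ i)) (at t within {0..})"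
    unfolding free_energy_def by (intro DERIV_sum)
  then show ?thesis
    by (simp add: nonadiabatic_epr_eq_flux[OF Q pos] sum.distrib sum_vector_matrix_mult_rate[OF Q])
qed

section \<open>Entropy production versus squared net inflows\<close>

text \<open>Apply ln u \<le> u - 1 to the square root of y / x. Using y / x itself would give only
  nonnegativity of the right-hand side; the root yields a full square.\<close>

lemma sqrt_diff_sq_le_entropy:
  fixes x y :: real
  assumes "0 < x" "0 < y"
  shows "(sqrt x - sqrt y)\<^sup>2 \<le> x * (ln x - ln y) - x + y"
proof -
  have "ln (sqrt y / sqrt x) \<le> sqrt y / sqrt x - 1"
    using assms by (intro ln_le_minus_one) simp
  then have "x * (ln y - ln x) \<le> x * (2 * (sqrt y / sqrt x - 1))"
    using assms by (intro mult_left_mono) (simp_all add: ln_div ln_sqrt)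
  also have "x * (2 * (sqrt y / sqrt x - 1)) = 2 * (x / sqrt x * sqrt y) - 2 * x"
    by (simp add: algebra_simps)
  also have "x / sqrt x = sqrt x"
    using assms by (simp add: real_div_sqrt)
  finally show ?thesis
    using assms by (simp add: power2_diff algebra_simps)
qed

context
  fixes Q :: "real^'n^'n" and \<mu> p :: "real^'n"
  assumes Q: "transition_rate_matrix Q"
    and steady: "\<mu> v* Q = 0"
    and mu_pos: "\<And>i. 0 < \<mu> $ i" and p_pos: "\<And>i. 0 < p $ i"
begin

lemma steady_inflow: "(\<Sum>j\<in>UNIV. \<mu> $ j * Q $ j $ i) = 0"
  using steady vector_matrix_mult_nth[of \<mu> Q i] by simp

lemma nonadiabatic_epr_ge_sqrt:
  "(\<Sum>i\<in>UNIV. \<Sum>j\<in>UNIV - {i}.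
      \<mu> $ j * Q $ j $ i * (sqrt (p $ j / \<mu> $ j) - sqrt (p $ i / \<mu> $ i))\<^sup>2)
    \<le> nonadiabatic_epr Q \<mu> p"
proof -
  define x where "x i = p $ i / \<mu> $ i" for i
  have x: "0 < x i" "p $ i = \<mu> $ i * x i" for i
    using mu_pos[of i] p_pos[of i] by (auto simp: x_def)
  \<comment> \<open>The added terms \<open>- x j + x i\<close> cost nothing in total: weighted by
    \<open>\<mu> $ j * Q $ j $ i\<close>, the first sums to zero by the row sums
    (\<open>out\<close>), the second by stationarity (\<open>inflow\<close>). The diagonal
    \<open>g i i\<close> is 0.\<close>
  define g where "g j i = x j * (ln (x j) - ln (x i)) - x j + x i" for j i
  have "(\<Sum>i\<in>UNIV. \<Sum>j\<in>UNIV. \<mu> $ j * Q $ j $ i * x j) = (\<Sum>j\<in>UNIV. \<Sum>i\<in>UNIV. \<mu> $ j * Q $ j $ i * x j)"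
    by (rule sum.swap)
  also have "\<dots> = (\<Sum>j\<in>UNIV. \<mu> $ j * x j * (\<Sum>i\<in>UNIV. Q $ j $ i))"
    by (simp add: sum_distrib_left algebra_simps)
  also have "\<dots> = 0"
    by (simp add: transition_rate_matrix_row_sum[OF Q])
  finally have out: "(\<Sum>i\<in>UNIV. \<Sum>j\<in>UNIV. \<mu> $ j * Q $ j $ i * x j) = 0" .
  have inflow: "(\<Sum>i\<in>UNIV. \<Sum>j\<in>UNIV. \<mu> $ j * Q $ j $ i * x i) = 0"
    by (simp add: steady_inflow flip: sum_distrib_right)
  have "(\<Sum>i\<in>UNIV. \<Sum>j\<in>UNIV - {i}. \<mu> $ j * Q $ j $ i * (sqrt (x j) - sqrt (x i))\<^sup>2)
      \<le> (\<Sum>i\<in>UNIV. \<Sum>j\<in>UNIV - {i}. \<mu> $ j * Q $ j $ i * g j i)"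
    unfolding g_def using x mu_pos
    by (intro sum_mono mult_left_mono sqrt_diff_sq_le_entropy mult_nonneg_nonneg
        transition_rate_matrix_nonneg[OF Q]) (auto intro: less_imp_le)
  also have "\<dots> = (\<Sum>i\<in>UNIV. \<Sum>j\<in>UNIV. \<mu> $ j * Q $ j $ i * g j i)"
    by (intro sum.cong sum.mono_neutral_left) (auto simp: g_def)
  also have "\<dots> = (\<Sum>i\<in>UNIV. \<Sum>j\<in>UNIV. p $ j * Q $ j $ i * (ln (x j) - ln (x i)))
      - (\<Sum>i\<in>UNIV. \<Sum>j\<in>UNIV. \<mu> $ j * Q $ j $ i * x j)
      + (\<Sum>i\<in>UNIV. \<Sum>j\<in>UNIV. \<mu> $ j * Q $ j $ i * x i)"
    unfolding x(2) g_def sum_subtractf[symmetric] sum.distrib[symmetric]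
    by (intro sum.cong refl) (simp add: algebra_simps)
  also have "\<dots> = nonadiabatic_epr Q \<mu> p"
    using nonadiabatic_epr_eq[of \<mu> p Q, OF mu_pos p_pos] out inflow by (simp add: x_def)
  finally show ?thesis
    by (simp add: x_def)
qed

text \<open>
  Factor \<open>x\<^sub>j - x\<^sub>i = (sqrt x\<^sub>j - sqrt x\<^sub>i) (sqrt x\<^sub>j + sqrt x\<^sub>i)\<close> and apply Cauchy-Schwarz; by
  stationarity of \<open>\<mu>\<close> the weights multiplying the second factor add up to the jump rates into and
  out of \<open>i\<close>, which is why no lower bound on \<open>\<mu>\<close> is needed.
\<close>

lemma net_inflow_sq_le:
  assumes "\<And>i. p $ i \<le> 1"
  shows "(\<Sum>j\<in>UNIV - {i}. p $ j * Q $ j $ i - p $ i * Q $ i $ j)\<^sup>2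
    \<le> 4 * (\<Sum>a\<in>UNIV. \<Sum>b\<in>UNIV. \<bar>Q $ a $ b\<bar>) * (\<Sum>j\<in>UNIV - {i}.
      \<mu> $ j * Q $ j $ i * (sqrt (p $ j / \<mu> $ j) - sqrt (p $ i / \<mu> $ i))\<^sup>2)"
proof -
  define x where "x i = p $ i / \<mu> $ i" for i
  have x: "0 < x i" "p $ i = \<mu> $ i * x i" for i
    using mu_pos[of i] p_pos[of i] by (auto simp: x_def)
  define w where "w j = \<mu> $ j * Q $ j $ i" for j
  define K where "K = (\<Sum>a\<in>UNIV. \<Sum>b\<in>UNIV. \<bar>Q $ a $ b\<bar>)"
  have w: "0 \<le> w j" if "j \<in> UNIV - {i}" for j
    using that mu_pos[of j] transition_rate_matrix_nonneg[OF Q, of j i] by (simp add: w_def)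
  have sum_w: "(\<Sum>j\<in>UNIV - {i}. w j) = - w i"
    using steady_inflow[of i] sum.remove[of UNIV i w] by (simp add: w_def)
  have Qii: "(\<Sum>j\<in>UNIV - {i}. Q $ i $ j) = - Q $ i $ i"
    using Q by (simp add: transition_rate_matrix_def)
  have "(\<Sum>j\<in>UNIV - {i}. p $ j * Q $ j $ i - p $ i * Q $ i $ j)
      = (\<Sum>j\<in>UNIV - {i}. w j * x j) + p $ i * Q $ i $ i"
    using Qii by (simp add: sum_subtractf w_def x(2) mult_ac flip: sum_distrib_left)
  \<comment> \<open>Stationarity trades the outflow from \<open>i\<close> for inflow weights
    \<open>w j\<close>, so the net inflow becomes a weighted sum of the differences
    \<open>x j - x i\<close> even without detailed balance.\<close>
  also have "p $ i * Q $ i $ i = - (\<Sum>j\<in>UNIV - {i}. w j * x i)"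
    using sum_w by (simp add: w_def x(2) flip: sum_distrib_right)
  also have "(\<Sum>j\<in>UNIV - {i}. w j * x j) + - (\<Sum>j\<in>UNIV - {i}. w j * x i)
      = (\<Sum>j\<in>UNIV - {i}. (sqrt (w j) * (sqrt (x j) - sqrt (x i)))
          * (sqrt (w j) * (sqrt (x j) + sqrt (x i))))"
    unfolding diff_conv_add_uminus[symmetric] sum_subtractf[symmetric]
  proof (rule sum.cong[OF refl])
    fix j assume "j \<in> UNIV - {i}"
    then have "w j = (sqrt (w j))\<^sup>2" "x j = (sqrt (x j))\<^sup>2" "x i = (sqrt (x i))\<^sup>2"
      using w x(1) by (simp_all add: less_imp_le)
    then show "w j * x j - w j * x i = (sqrt (w j) * (sqrt (x j) - sqrt (x i)))
        * (sqrt (w j) * (sqrt (x j) + sqrt (x i)))"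
      by algebra
  qed
  finally have "(\<Sum>j\<in>UNIV - {i}. p $ j * Q $ j $ i - p $ i * Q $ i $ j)\<^sup>2
      \<le> (\<Sum>j\<in>UNIV - {i}. (sqrt (w j) * (sqrt (x j) - sqrt (x i)))\<^sup>2)
        * (\<Sum>j\<in>UNIV - {i}. (sqrt (w j) * (sqrt (x j) + sqrt (x i)))\<^sup>2)"
    by (simp only: Cauchy_Schwarz_ineq_sum)
  also have "\<dots> = (\<Sum>j\<in>UNIV - {i}. w j * (sqrt (x j) - sqrt (x i))\<^sup>2)
        * (\<Sum>j\<in>UNIV - {i}. w j * (sqrt (x j) + sqrt (x i))\<^sup>2)"
    using w by (simp add: power_mult_distrib)
  \<comment> \<open>The 4 is a factor 2 from (a + b)^2 \<le> 2 (a^2 + b^2) times two sums, the jump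
    flow of \<open>p\<close> into \<open>i\<close> and the flow out of \<open>i\<close>, each at
    most \<open>K\<close> because components of \<open>p\<close> are at most 1.\<close>
  also have "\<dots> \<le> (\<Sum>j\<in>UNIV - {i}. w j * (sqrt (x j) - sqrt (x i))\<^sup>2) * (4 * K)"
  proof (rule mult_left_mono)
    have "(\<Sum>j\<in>UNIV - {i}. w j * (sqrt (x j) + sqrt (x i))\<^sup>2)
        \<le> (\<Sum>j\<in>UNIV - {i}. w j * (2 * (x j + x i)))"
    proof (intro sum_mono mult_left_mono w)
      fix j
      show "(sqrt (x j) + sqrt (x i))\<^sup>2 \<le> 2 * (x j + x i)"
        using sum_squares_bound[of "sqrt (x j)" "sqrt (x i)"] x(1)[of i] x(1)[of j]
        by (simp add: power2_sum)
    qed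
    also have "\<dots> = 2 * ((\<Sum>j\<in>UNIV - {i}. w j * x j) + (\<Sum>j\<in>UNIV - {i}. w j) * x i)"
      by (simp add: sum_distrib_left sum_distrib_right algebra_simps flip: sum.distrib)
    also have "(\<Sum>j\<in>UNIV - {i}. w j) * x i = p $ i * \<bar>Q $ i $ i\<bar>"
      using transition_rate_matrix_diag_nonpos[OF Q, of i] unfolding sum_w by (simp add: w_def x(2))
    also have "p $ i * \<bar>Q $ i $ i\<bar> \<le> K"
    proof -
      have "p $ i * \<bar>Q $ i $ i\<bar> \<le> \<bar>Q $ i $ i\<bar>"
        using assms[of i] by (simp add: mult_left_le_one_le p_pos less_imp_le)
      also have "\<dots> \<le> (\<Sum>b\<in>UNIV. \<bar>Q $ i $ b\<bar>)"
        by (rule member_le_sum) auto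
      also have "\<dots> \<le> K"
        unfolding K_def by (rule member_le_sum) (auto intro: sum_nonneg)
      finally show ?thesis .
    qed
    also have "(\<Sum>j\<in>UNIV - {i}. w j * x j) \<le> K"
    proof -
      have "(\<Sum>j\<in>UNIV - {i}. w j * x j) \<le> (\<Sum>j\<in>UNIV - {i}. \<Sum>b\<in>UNIV. \<bar>Q $ j $ b\<bar>)"
      proof (rule sum_mono)
        fix j
        have "w j * x j = p $ j * Q $ j $ i"
          by (simp add: w_def x(2))
        also have "\<dots> \<le> p $ j * \<bar>Q $ j $ i\<bar>"
          using p_pos[of j] by (intro mult_left_mono) auto
        also have "\<dots> \<le> \<bar>Q $ j $ i\<bar>"
          using assms[of j] by (simp add: mult_left_le_one_le p_pos less_imp_le)
        also have "\<dots> \<le> (\<Sum>b\<in>UNIV. \<bar>Q $ j $ b\<bar>)"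
          by (rule member_le_sum) auto
        finally show "w j * x j \<le> (\<Sum>b\<in>UNIV. \<bar>Q $ j $ b\<bar>)" .
      qed
      also have "\<dots> \<le> K"
        unfolding K_def by (rule sum_mono2) (auto intro: sum_nonneg)
      finally show ?thesis .
    qed
    finally show "(\<Sum>j\<in>UNIV - {i}. w j * (sqrt (x j) + sqrt (x i))\<^sup>2) \<le> 4 * K"
      by simp
    show "0 \<le> (\<Sum>j\<in>UNIV - {i}. w j * (sqrt (x j) - sqrt (x i))\<^sup>2)"
      using w by (intro sum_nonneg) simp
  qed
  finally show ?thesis
    by (simp add: w_def x_def K_def mult_ac)
qed

end

section \<open>The constant, uniform in the solution\<close>

theorem theorem3p3:
  fixes Q :: "real^'n^'n"
  assumes "transition_rate_matrix Q" and "irreducible_rates Q"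
  shows "\<exists>c\<^sub>1>0. \<forall>\<mu> p.
    steady_state Q \<mu> \<and> master_solution Q p \<and> prob_vector (p 0) \<longrightarrow>
      (\<forall>t>0. \<forall>i. 0 < p t $ i) \<and>
      (\<forall>t\<ge>0. (\<forall>i. 0 < p t $ i) \<longrightarrow>
        ((\<lambda>s. free_energy \<mu> (p s)) has_real_derivative - nonadiabatic_epr Q \<mu> (p t))
          (at t within {0..}) \<and>
        nonadiabatic_epr Q \<mu> (p t) \<ge>
          c\<^sub>1 * (\<Sum>i\<in>UNIV. (\<Sum>j\<in>UNIV - {i}. p t $ j * Q $ j $ i - p t $ i * Q $ i $ j)\<^sup>2))"
proof -
  define K where "K = (\<Sum>a\<in>UNIV. \<Sum>b\<in>UNIV. \<bar>Q $ a $ b\<bar>)"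
  have K: "0 \<le> K"
    by (simp add: K_def sum_nonneg)
  \<comment> \<open>\<open>K\<close> depends on \<open>Q\<close> alone. The extra 1 keeps the
    denominator positive when \<open>K = 0\<close>, as happens for a single state.\<close>
  have bound: "1 / (4 * K + 1) *
      (\<Sum>i\<in>UNIV. (\<Sum>j\<in>UNIV - {i}. v $ j * Q $ j $ i - v $ i * Q $ i $ j)\<^sup>2)
      \<le> nonadiabatic_epr Q \<mu> v"
    if mu: "steady_state Q \<mu>" and v: "prob_vector v" "\<And>i. 0 < v $ i" for \<mu> v
  proof -
    have mu_pos: "0 < \<mu> $ i" for i
      using steady_state_pos[OF assms mu] .
    have steady: "\<mu> v* Q = 0"
      using mu by (simp add: steady_state_def)
    have v_le: "v $ i \<le> 1" for i
      using member_le_sum[of i UNIV "\<lambda>i. v $ i"] v(1) by (simp add: prob_vector_def)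
    define S where "S i = (\<Sum>j\<in>UNIV - {i}.
      \<mu> $ j * Q $ j $ i * (sqrt (v $ j / \<mu> $ j) - sqrt (v $ i / \<mu> $ i))\<^sup>2)" for i
    have S: "0 \<le> S i" for i
      unfolding S_def using mu_pos transition_rate_matrix_nonneg[OF assms(1)]
      by (intro sum_nonneg mult_nonneg_nonneg) (auto intro: less_imp_le)
    have "(\<Sum>i\<in>UNIV. (\<Sum>j\<in>UNIV - {i}. v $ j * Q $ j $ i - v $ i * Q $ i $ j)\<^sup>2)
        \<le> (\<Sum>i\<in>UNIV. 4 * K * S i)"
      unfolding K_def S_def
      by (intro sum_mono net_inflow_sq_le[OF assms(1) steady mu_pos v(2) v_le])
    also have "\<dots> = 4 * K * (\<Sum>i\<in>UNIV. S i)"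
      by (simp add: sum_distrib_left)
    also have "\<dots> \<le> (4 * K + 1) * (\<Sum>i\<in>UNIV. S i)"
      using S by (simp add: sum_nonneg mult_right_mono)
    also have "\<dots> \<le> (4 * K + 1) * nonadiabatic_epr Q \<mu> v"
      unfolding S_def using K
      by (intro mult_left_mono nonadiabatic_epr_ge_sqrt[OF assms(1) steady mu_pos v(2)]) auto
    finally show ?thesis
      using K by (simp add: field_simps)
  qed
  show ?thesis
  proof (intro exI[of _ "1 / (4 * K + 1)"] conjI allI impI)
    show "0 < 1 / (4 * K + 1)"
      using K by simp
  next
    fix \<mu> p t i
    assume "steady_state Q \<mu> \<and> master_solution Q p \<and> prob_vector (p 0)" "0 < (t::real)"
    then show "0 < p t $ i"
      using master_solution_pos[OF assms] by blast
  next
    fix \<mu> p t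
    assume A: "steady_state Q \<mu> \<and> master_solution Q p \<and> prob_vector (p 0)"
      and t: "0 \<le> (t::real)" and pos: "\<forall>i. 0 < p t $ i"
    show "((\<lambda>s. free_energy \<mu> (p s)) has_real_derivative - nonadiabatic_epr Q \<mu> (p t))
        (at t within {0..})"
      using free_energy_deriv[OF assms(1) _ t, of p \<mu>] steady_state_pos[OF assms] A pos by blast
    show "1 / (4 * K + 1) *
        (\<Sum>i\<in>UNIV. (\<Sum>j\<in>UNIV - {i}. p t $ j * Q $ j $ i - p t $ i * Q $ i $ j)\<^sup>2)
        \<le> nonadiabatic_epr Q \<mu> (p t)"
      using bound master_solution_prob_vector[OF assms(1) _ _ t] A pos by blast
  qed
qed

end
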